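(* Let $\mathbb{F}$ be a field. All nonzero multiples of $(x_1+1)\cdots(x_n+1)$ in $\mathbb{F}[x_1,\ldots,x_n]$ require sparsity $\ge2^n$. Similarly, all nonzero multiples of $(x_1+y_1)\cdots(x_n+y_n)$ in $\mathbb{F}[x_1,\ldots,x_n,y_1,\ldots,y_n]$ require sparsity $\ge2^n$.
   Context: The sparsity of a polynomial is the number of monomials with nonzero coefficient in it. *)

theory Defs
  imports "HOL-Library.Poly_Mapping"
begin

text \<open>
  Polynomials with coefficients in \<open>'a\<close> and variables indexed by \<open>'v\<close>, as finitely supported
  functions from exponent vectors to coefficients.  The multiplication that the library puts on
  this type is convolution, that is, polynomial multiplication.  The monomials with nonzero
  coefficient in \<open>p\<close> are the elements of \<open>Poly_Mapping.keys p\<close>.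
\<close>
type_synonym ('v, 'a) mpoly = "('v \<Rightarrow>\<^sub>0 nat) \<Rightarrow>\<^sub>0 'a"

definition var :: "'v \<Rightarrow> ('v, 'a::comm_semiring_1) mpoly"
  where "var v = Poly_Mapping.single (Poly_Mapping.single v 1) 1"

text \<open>
  The subring of polynomials in the variables from \<open>V\<close>.  It is needed because the index
  type \<open>'v\<close> is in general larger than the set of variables of the polynomial ring one is
  working in.
\<close>
definition poly_ring :: "'v set \<Rightarrow> ('v, 'a::comm_semiring_1) mpoly set"
  where "poly_ring V = {p. \<forall>m\<in>Poly_Mapping.keys p. Poly_Mapping.keys m \<subseteq> V}"

definition sparsity :: "('v, 'a::comm_semiring_1) mpoly \<Rightarrow> nat"
  where "sparsity p = card (Poly_Mapping.keys p)"

definition multiples :: "'v set \<Rightarrow> ('v, 'a::comm_semiring_1) mpoly \<Rightarrow> ('v, 'a) mpoly set"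
  where "multiples V g = {q * g | q. q \<in> poly_ring V}"

end

theory Submission
  imports Defs
begin

text \<open>
  Induct on the number of factors, peeling off a factor with variable \<open>u\<close>.  Write the multiple as
  \<open>h * (u + v)\<close> and let \<open>a \<le> b\<close> be the least and the greatest degree of \<open>h\<close> in \<open>u\<close>.  The parts
  of the product of degrees \<open>a\<close> and \<open>b + 1\<close> in \<open>u\<close> are \<open>v * h\<^sub>a\<close> and \<open>u * h\<^sub>b\<close>, which are disjoint
  and have as many monomials as \<open>h\<^sub>a\<close> and \<open>h\<^sub>b\<close>.  These are again nonzero multiples of the remaining
  factors, because the latter do not involve \<open>u\<close>.
\<close>

text \<open>The weight \<open>w\<close> is left abstract; below it is the degree in a single
  variable.\<close>

definition homog_part :: "('m \<Rightarrow> nat) \<Rightarrow> nat \<Rightarrow> ('m \<Rightarrow>\<^sub>0 'a::zero) \<Rightarrow> ('m \<Rightarrow>\<^sub>0 'a)"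
  where "homog_part w d = Poly_Mapping.mapp (\<lambda>m c. c when w m = d)"

lemma lookup_homog_part:
  "Poly_Mapping.lookup (homog_part w d p) m = (Poly_Mapping.lookup p m when w m = d)"
  by (simp add: homog_part_def lookup_mapp when_def in_keys_iff)

lemma keys_homog_part:
  "Poly_Mapping.keys (homog_part w d p) = {m \<in> Poly_Mapping.keys p. w m = d}"
  by (auto simp: in_keys_iff lookup_homog_part)

lemma homog_part_eq_0_iff:
  "homog_part w d p = 0 \<longleftrightarrow> (\<forall>m\<in>Poly_Mapping.keys p. w m \<noteq> d)"
  by (auto simp flip: keys_eq_empty simp: keys_homog_part)

lemma homog_part_add:
  "homog_part w d (p + q) = homog_part w d p + homog_part w d (q :: 'm \<Rightarrow>\<^sub>0 'a::monoid_add)"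
  by (rule poly_mapping_eqI) (simp add: lookup_homog_part lookup_add when_def)

text \<open>All monomials of \<open>r\<close> have weight \<open>c\<close> and \<open>w\<close> is
  additive, so a term of \<open>p\<close> contributes to weight \<open>d + c\<close> exactly when
  its own weight is \<open>d\<close>.\<close>

lemma homog_part_mult:
  fixes p r :: "'m::monoid_add \<Rightarrow>\<^sub>0 'a::semiring_0"
  assumes add: "\<And>x y. w (x + y) = w x + w y"
    and r: "\<And>m. m \<in> Poly_Mapping.keys r \<Longrightarrow> w m = c"
  shows "homog_part w (d + c) (p * r) = homog_part w d p * r"
proof (rule poly_mapping_eqI)
  fix k
  let ?R = "\<lambda>l. \<Sum>q. Poly_Mapping.lookup r q when k = l + q"
  \<comment> \<open>\<open>?R l\<close> is the factor that the convolution attaches to the term of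
    \<open>p\<close> at \<open>l\<close>; filtering by the weight of \<open>k\<close> or by that of
    \<open>l\<close> is the same wherever it is nonzero.\<close>
  have R: "?R l = 0" if "w k \<noteq> w l + c" for l
  proof -
    have "(Poly_Mapping.lookup r q when k = l + q) = 0" for q
      using that r[of q] by (cases "Poly_Mapping.lookup r q = 0") (auto simp: when_def add in_keys_iff)
    then show ?thesis by simp
  qed
  have "(Poly_Mapping.lookup p l * ?R l when w k = d + c) =
      (Poly_Mapping.lookup p l when w l = d) * ?R l" for l
    using R[of l] by (cases "w k = w l + c") (auto simp: when_def)
  then have "(\<Sum>l. Poly_Mapping.lookup p l * ?R l when w k = d + c) =
      (\<Sum>l. (Poly_Mapping.lookup p l when w l = d) * ?R l)"
    by presburger
  then show "Poly_Mapping.lookup (homog_part w (d + c) (p * r)) k =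
      Poly_Mapping.lookup (homog_part w d p * r) k"
    by (cases "w k = d + c") (simp_all add: lookup_homog_part lookup_mult)
qed

text \<open>Multiplying by a monomial with coefficient 1 translates the support by \<open>m\<close>,
  and translation is injective by cancellation.\<close>

lemma card_keys_mult_single_one:
  fixes p :: "'m::cancel_comm_monoid_add \<Rightarrow>\<^sub>0 'a::comm_semiring_1"
  shows "card (Poly_Mapping.keys (p * Poly_Mapping.single m 1)) = card (Poly_Mapping.keys p)"
proof -
  have lookup: "Poly_Mapping.lookup (p * Poly_Mapping.single m 1) k =
      (\<Sum>l. Poly_Mapping.lookup p l when k = l + m)" for k
  proof -
    have "(\<Sum>q. Poly_Mapping.lookup (Poly_Mapping.single m 1) q when k = l + q) =
        ((1::'a) when k = l + m)" for l
    proof -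
      have "(Poly_Mapping.lookup (Poly_Mapping.single m (1::'a)) q when k = l + q) =
          ((1 when k = l + m) when q = m)" for q
        by (auto simp: lookup_single when_def)
      then show ?thesis by simp
    qed
    then show ?thesis
      by (simp add: lookup_mult mult_when)
  qed
  have "Poly_Mapping.lookup (p * Poly_Mapping.single m 1) (l + m) = Poly_Mapping.lookup p l" for l
    by (simp add: lookup)
  moreover have "k \<in> (\<lambda>l. l + m) ` Poly_Mapping.keys p"
    if "k \<in> Poly_Mapping.keys (p * Poly_Mapping.single m 1)" for k
    using keys_mult[of p "Poly_Mapping.single m 1"] that by auto
  ultimately have
    "Poly_Mapping.keys (p * Poly_Mapping.single m 1) = (\<lambda>l. l + m) ` Poly_Mapping.keys p"
    by (auto simp: in_keys_iff)
  then show ?thesis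
    by (simp add: card_image)
qed

text \<open>Covers both claims at once: \<open>A i\<close> stands for \<open>x_i\<close>,
  \<open>B i\<close> for 1 or \<open>y_i\<close>, and \<open>w i\<close> for the degree in
  \<open>x_i\<close>. The cofactor \<open>q\<close> is arbitrary, since the induction replaces it by
  one of its homogeneous parts.\<close>

lemma sparsity_prod_binomials:
  fixes q :: "'m::cancel_comm_monoid_add \<Rightarrow>\<^sub>0 'a::comm_semiring_1"
    and w :: "'i \<Rightarrow> 'm \<Rightarrow> nat"
  assumes "finite I"
    and add: "\<And>i x y. w i (x + y) = w i x + w i y"
    and wA: "\<And>i j. i \<in> I \<Longrightarrow> j \<in> I \<Longrightarrow> w i (A j) = (if i = j then 1 else 0)"
    and wB: "\<And>i j. i \<in> I \<Longrightarrow> j \<in> I \<Longrightarrow> w i (B j) = 0"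
    and "q * (\<Prod>i\<in>I. Poly_Mapping.single (A i) 1 + Poly_Mapping.single (B i) 1) \<noteq> 0"
  shows "2 ^ card I \<le> card (Poly_Mapping.keys
    (q * (\<Prod>i\<in>I. Poly_Mapping.single (A i) 1 + Poly_Mapping.single (B i) 1)))"
  using assms(1) wA wB assms(5)
proof (induction I arbitrary: q rule: finite_induct)
  case empty
  then show ?case
    by (simp add: Suc_le_eq card_gt_0_iff)
next
  case (insert j I)
  define P where "P = (\<Prod>i\<in>I. Poly_Mapping.single (A i) (1::'a) + Poly_Mapping.single (B i) 1)"
  define h where "h = q * P"
  let ?A = "Poly_Mapping.single (A j) (1::'a)" and ?B = "Poly_Mapping.single (B j) (1::'a)"
  have f: "q * (\<Prod>i\<in>insert j I. Poly_Mapping.single (A i) 1 + Poly_Mapping.single (B i) 1) =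
      h * ?A + h * ?B" (is "?f = _")
    using insert.hyps by (simp add: h_def P_def algebra_simps)
  have "h \<noteq> 0"
    using insert.prems(3) unfolding f by auto
  \<comment> \<open>\<open>Min D\<close> and \<open>Max D\<close> are the extreme degrees of
    \<open>h\<close> in the variable being peeled off.\<close>
  define D where "D = w j ` Poly_Mapping.keys h"
  have D: "finite D" "D \<noteq> {}"
    using \<open>h \<noteq> 0\<close> by (auto simp: D_def)
  have w0: "w j 0 = 0"
    using add[of j 0 0] by simp
  have P0: "w j m = 0" if "m \<in> Poly_Mapping.keys P" for m
  proof -
    have "\<forall>m\<in>Poly_Mapping.keys
        (\<Prod>i\<in>J. Poly_Mapping.single (A i) (1::'a) + Poly_Mapping.single (B i) 1). w j m = 0"
      if "finite J" "J \<subseteq> I" for J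
      using that
    proof (induction J rule: finite_induct)
      case empty
      then show ?case by (simp add: w0)
    next
      case (insert i J)
      have "w j m = 0"
        if "m \<in> Poly_Mapping.keys (Poly_Mapping.single (A i) (1::'a) + Poly_Mapping.single (B i) 1)"
        for m
        using subsetD[OF Poly_Mapping.keys_add that] insert.prems insert.hyps \<open>j \<notin> I\<close>
          \<open>\<And>i k. i \<in> Set.insert j I \<Longrightarrow> k \<in> Set.insert j I \<Longrightarrow> w i (A k) = (if i = k then 1 else 0)\<close>
          \<open>\<And>i k. i \<in> Set.insert j I \<Longrightarrow> k \<in> Set.insert j I \<Longrightarrow> w i (B k) = 0\<close>
        by (auto split: if_splits)
      with insert show ?case
        using keys_mult by (fastforce simp: add)
    qed
    from this[of I] show ?thesis
      using insert.hyps that by (auto simp: P_def)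
  qed
  have shift_A: "homog_part (w j) (Suc d) (h * ?A) = homog_part (w j) d h * ?A" for d
    using homog_part_mult[of "w j" ?A 1 d h] insert.prems(1) add by simp
  \<comment> \<open>Multiplication by \<open>?A\<close> raises the weight by one, so this part could
    only come from weight \<open>Min D - 1\<close> in \<open>h\<close>, which does not occur. Weight
    0 is separate because \<open>shift_A\<close> only reaches successors.\<close>
  have shift_A0: "homog_part (w j) (Min D) (h * ?A) = 0"
  proof (cases "Min D")
    case 0
    then show ?thesis
      using keys_mult[of h ?A] insert.prems(1)[of j j]
      by (fastforce simp: homog_part_eq_0_iff add)
  next
    case (Suc d)
    have "d \<notin> D"
      using Min_le[OF D(1), of d] Suc by auto
    then have "homog_part (w j) d h = 0"
      by (auto simp: homog_part_eq_0_iff D_def)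
    with Suc shift_A show ?thesis by simp
  qed
  have shift_B: "homog_part (w j) d (h * ?B) = homog_part (w j) d h * ?B" for d
    using homog_part_mult[of "w j" ?B 0 d h] insert.prems(2) add by simp
  have shift_B0: "homog_part (w j) (Suc (Max D)) (h * ?B) = 0"
  proof -
    have "Suc (Max D) \<notin> D"
      using Max_ge[OF D(1), of "Suc (Max D)"] by auto
    then have "homog_part (w j) (Suc (Max D)) h = 0"
      unfolding homog_part_eq_0_iff D_def by force
    then show ?thesis by (simp add: shift_B)
  qed
  have IH: "2 ^ card I \<le> card (Poly_Mapping.keys (homog_part (w j) d h))" if "d \<in> D" for d
  proof -
    \<comment> \<open>As \<open>P\<close> has weight 0, the part of \<open>h\<close> is again a
      multiple of \<open>P\<close>, so the induction hypothesis applies to it.\<close>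
    have "homog_part (w j) d h = homog_part (w j) d q * P"
      using homog_part_mult[of "w j" P 0 d q] P0 add by (simp add: h_def)
    moreover have "homog_part (w j) d h \<noteq> 0"
      using that by (auto simp: homog_part_eq_0_iff D_def)
    ultimately show ?thesis
      using insert.IH[of "homog_part (w j) d q"] insert.prems by (simp add: P_def)
  qed
  have low: "2 ^ card I \<le> card (Poly_Mapping.keys (homog_part (w j) (Min D) ?f))"
    using IH[OF Min_in[OF D]]
    by (simp add: f homog_part_add shift_A0 shift_B card_keys_mult_single_one)
  have high: "2 ^ card I \<le> card (Poly_Mapping.keys (homog_part (w j) (Suc (Max D)) ?f))"
    using IH[OF Max_in[OF D]]
    by (simp add: f homog_part_add shift_A shift_B0 card_keys_mult_single_one)
  \<comment> \<open>Distinct weights make the two supports disjoint, so their sizes add up to the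
    doubled bound, even when \<open>Min D = Max D\<close>.\<close>
  have "Min D < Suc (Max D)"
    using D by (simp add: less_Suc_eq_le)
  then have "card (Poly_Mapping.keys (homog_part (w j) (Min D) ?f)) +
      card (Poly_Mapping.keys (homog_part (w j) (Suc (Max D)) ?f)) =
      card (Poly_Mapping.keys (homog_part (w j) (Min D) ?f) \<union>
        Poly_Mapping.keys (homog_part (w j) (Suc (Max D)) ?f))"
    by (subst card_Un_disjoint) (auto simp: keys_homog_part)
  also have "\<dots> \<le> card (Poly_Mapping.keys ?f)"
    by (rule card_mono) (auto simp: keys_homog_part)
  finally show ?case
    using low high insert.hyps by simp
qed

theorem corollary6p13:
  fixes n :: nat
  shows "(\<forall>f :: (nat, 'a::field) mpoly.
            f \<in> multiples {1..n} (\<Prod>i\<in>{1..n}. (var i + 1)) \<and> f \<noteq> 0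
              \<longrightarrow> sparsity f \<ge> 2 ^ n) \<and>
         (\<forall>f :: (nat + nat, 'a) mpoly.
            f \<in> multiples ({1..n} <+> {1..n}) (\<Prod>i\<in>{1..n}. (var (Inl i) + var (Inr i))) \<and> f \<noteq> 0
              \<longrightarrow> sparsity f \<ge> 2 ^ n)"
proof (intro conjI allI impI; elim conjE)
  fix f :: "(nat, 'a) mpoly"
  assume "f \<in> multiples {1..n} (\<Prod>i\<in>{1..n}. (var i + 1))" and "f \<noteq> 0"
  \<comment> \<open>The constant 1 is the monomial with exponent vector 0.\<close>
  then obtain q where "f = q * (\<Prod>i\<in>{1..n}. Poly_Mapping.single (Poly_Mapping.single i 1) 1
      + Poly_Mapping.single 0 1)"
    by (auto simp: multiples_def var_def)
  with \<open>f \<noteq> 0\<close> show "sparsity f \<ge> 2 ^ n"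
    using sparsity_prod_binomials[of "{1..n}" "\<lambda>i m. Poly_Mapping.lookup m i"
        "\<lambda>i. Poly_Mapping.single i 1" "\<lambda>_. 0" q]
    by (auto simp: sparsity_def lookup_add lookup_single when_def)
next
  fix f :: "(nat + nat, 'a) mpoly"
  assume "f \<in> multiples ({1..n} <+> {1..n}) (\<Prod>i\<in>{1..n}. (var (Inl i) + var (Inr i)))"
    and "f \<noteq> 0"
  then obtain q where "f = q * (\<Prod>i\<in>{1..n}. Poly_Mapping.single (Poly_Mapping.single (Inl i) 1) 1
      + Poly_Mapping.single (Poly_Mapping.single (Inr i) 1) 1)"
    by (auto simp: multiples_def var_def)
  with \<open>f \<noteq> 0\<close> show "sparsity f \<ge> 2 ^ n"
    \<comment> \<open>The weights count only the \<open>x_i\<close>, so each \<open>y_i\<close> has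
      weight 0, just like the constant 1 before.\<close>
    using sparsity_prod_binomials[of "{1..n}" "\<lambda>i m. Poly_Mapping.lookup m (Inl i)"
        "\<lambda>i. Poly_Mapping.single (Inl i) 1" "\<lambda>i. Poly_Mapping.single (Inr i) 1" q]
    by (auto simp: sparsity_def lookup_add lookup_single when_def)
qed

end
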